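(* Let $n,k\ge1$ be integers and let $X$ be the Markov chain on $\mathbb{E}=\{0,\ldots,k\}^n$ with transition probabilities, for $e=(e(1),\ldots,e(n))$ and $e'=(e'(1),\ldots,e'(n))$ in $\mathbb{E}$, $$P(e,e')=\begin{cases}\frac12 & \text{if } e=e',\\[3pt] \frac{1}{2nk} & \text{if for some } i,\ e(i)\ne e'(i)\ \text{and } e(j)=e'(j)\ \text{for all } j\neq i,\\[3pt] 0&\text{otherwise.}\end{cases}$$ Assume that $X$ starts at $e_1=(0,\ldots,0)$. For $A\subseteq\{1,\ldots,n\}$ let $e_A^{(k)}\in\mathbb{E}$ be the state with $e_A^{(k)}(i)=k$ if $i\in A$ and $e_A^{(k)}(i)=0$ if $i\notin A$. Then there exists a sharp strong stationary dual chain $X^*$ for $X$ on the state space $\mathbb{E}^*=\mathbb{E}$, with absorbing state $e_M=(k,\ldots,k)$, starting with probability $1$ at $e_1$, and having transition probabilities, for all $A\subseteq\{1,\ldots,n\}$ and $j\in\{1,\ldots,n\}\setminus A$, $$P^*\big(e_A^{(k)},e_{A\cup\{j\}}^{(k)}\big)=\frac{k+1}{2nk},$$ and, for all $A\subseteq\{1,\ldots,n\}$, $$P^*\big(e_A^{(k)},e_A^{(k)}\big)=\frac{n(k-1)+|A|(k+1)}{2nk},$$ with all other transitions out of states of the form $e_A^{(k)}$ having probability $0$.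
   Context: Strong stationary duality. Let $X$ be an ergodic Markov chain on a finite set $\mathbb{E}$ with transition matrix $P$, initial distribution $\nu$ and stationary distribution $\pi$. A Markov chain $X^*$ with state space $\mathbb{E}^*$, transition matrix $P^*$, initial distribution $\nu^*$ and an absorbing state $e_a^*$ is a strong stationary dual (SSD) chain for $X$ if there is a stochastic kernel (link) $\Lambda(e^*,e)$, $e^*\in\mathbb{E}^*$, $e\in\mathbb{E}$, with $\Lambda(e_a^*,\cdot)=\pi$, $\nu=\nu^*\Lambda$ and $\Lambda P=P^*\Lambda$. With $T^*$ the absorption time of $X^*$ in $e_a^*$, and separation distance $s(\nu P^m,\pi)=\max_{e\in\mathbb{E}}\left(1-\nu P^m(e)/\pi(e)\right)$, the SSD chain is called sharp if $s(\nu P^m,\pi)=P(T^*>m)$ for all $m\ge0$. In this statement the initial distribution of $X$ is $\nu=\delta_{e_1}$, and the stationary distribution $\pi$ of $X$ is uniform on $\mathbb{E}$. *)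

theory Defs
  imports "HOL-Probability.Probability" "HOL-Library.Extended_Nat"
begin

text \<open>
  A finite state space is a carrier set; vectors and matrices indexed by carriers are real functions
  whose values outside the carriers are irrelevant.
\<close>

definition prob_vector :: "'s set \<Rightarrow> ('s \<Rightarrow> real) \<Rightarrow> bool" where
  "prob_vector E \<mu> \<longleftrightarrow> (\<forall>e\<in>E. 0 \<le> \<mu> e) \<and> (\<Sum>e\<in>E. \<mu> e) = 1"

definition stochastic_kernel :: "'s set \<Rightarrow> 't set \<Rightarrow> ('s \<Rightarrow> 't \<Rightarrow> real) \<Rightarrow> bool" where
  "stochastic_kernel E F K \<longleftrightarrow> (\<forall>e\<in>E. prob_vector F (K e))"

definition vec_mult :: "'s set \<Rightarrow> ('s \<Rightarrow> real) \<Rightarrow> ('s \<Rightarrow> 't \<Rightarrow> real) \<Rightarrow> 't \<Rightarrow> real" where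
  "vec_mult E \<mu> K f = (\<Sum>e\<in>E. \<mu> e * K e f)"

definition mat_mult :: "'s set \<Rightarrow> ('r \<Rightarrow> 's \<Rightarrow> real) \<Rightarrow> ('s \<Rightarrow> 't \<Rightarrow> real) \<Rightarrow> 'r \<Rightarrow> 't \<Rightarrow> real" where
  "mat_mult E K L d f = (\<Sum>e\<in>E. K d e * L e f)"

definition point_mass :: "'s \<Rightarrow> 's \<Rightarrow> real" where
  "point_mass a e = (if e = a then 1 else 0)"

primrec mat_power :: "'s set \<Rightarrow> ('s \<Rightarrow> 's \<Rightarrow> real) \<Rightarrow> nat \<Rightarrow> 's \<Rightarrow> 's \<Rightarrow> real" where
  "mat_power E P 0 = point_mass"
| "mat_power E P (Suc m) = mat_mult E (mat_power E P m) P"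

definition irreducible_chain :: "'s set \<Rightarrow> ('s \<Rightarrow> 's \<Rightarrow> real) \<Rightarrow> bool" where
  "irreducible_chain E P \<longleftrightarrow> (\<forall>e\<in>E. \<forall>f\<in>E. \<exists>m. mat_power E P m e f > 0)"

definition aperiodic_chain :: "'s set \<Rightarrow> ('s \<Rightarrow> 's \<Rightarrow> real) \<Rightarrow> bool" where
  "aperiodic_chain E P \<longleftrightarrow> (\<forall>e\<in>E. Gcd {m. m > 0 \<and> mat_power E P m e e > 0} = 1)"

definition stationary :: "'s set \<Rightarrow> ('s \<Rightarrow> 's \<Rightarrow> real) \<Rightarrow> ('s \<Rightarrow> real) \<Rightarrow> bool" where
  "stationary E P \<pi> \<longleftrightarrow> prob_vector E \<pi> \<and> (\<forall>e\<in>E. vec_mult E \<pi> P e = \<pi> e)"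

definition ergodic_chain ::
    "'s set \<Rightarrow> ('s \<Rightarrow> real) \<Rightarrow> ('s \<Rightarrow> 's \<Rightarrow> real) \<Rightarrow> ('s \<Rightarrow> real) \<Rightarrow> bool" where
  "ergodic_chain E \<nu> P \<pi> \<longleftrightarrow>
     finite E \<and> prob_vector E \<nu> \<and> stochastic_kernel E E P \<and>
     irreducible_chain E P \<and> aperiodic_chain E P \<and> stationary E P \<pi>"

definition separation :: "'s set \<Rightarrow> ('s \<Rightarrow> real) \<Rightarrow> ('s \<Rightarrow> real) \<Rightarrow> real" where
  "separation E \<mu> \<pi> = Max ((\<lambda>e. 1 - \<mu> e / \<pi> e) ` E)"

text \<open>
  A process on a probability space that is a time-homogeneous Markov chain with the given
  initial distribution and transition matrix.
\<close>

definition markov_chain ::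
    "'w measure \<Rightarrow> (nat \<Rightarrow> 'w \<Rightarrow> 's) \<Rightarrow> 's set \<Rightarrow> ('s \<Rightarrow> real) \<Rightarrow> ('s \<Rightarrow> 's \<Rightarrow> real) \<Rightarrow> bool" where
  "markov_chain M X E \<nu> P \<longleftrightarrow>
     prob_space M \<and> finite E \<and> prob_vector E \<nu> \<and> stochastic_kernel E E P \<and>
     (\<forall>t. X t \<in> measurable M (count_space E)) \<and>
     (\<forall>e\<in>E. \<P>(\<omega> in M. X 0 \<omega> = e) = \<nu> e) \<and>
     (\<forall>t x. (\<forall>s\<le>Suc t. x s \<in> E) \<longrightarrow> \<P>(\<omega> in M. \<forall>s\<le>t. X s \<omega> = x s) > 0 \<longrightarrow>
        \<P>(\<omega> in M. X (Suc t) \<omega> = x (Suc t) \<bar> \<forall>s\<le>t. X s \<omega> = x s) = P (x t) (x (Suc t)))"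

text \<open>The time is \<open>\<infinity>\<close>, the infimum of the empty set, on paths that never reach \<open>a\<close>.\<close>

definition absorption_time :: "(nat \<Rightarrow> 'w \<Rightarrow> 's) \<Rightarrow> 's \<Rightarrow> 'w \<Rightarrow> enat" where
  "absorption_time X a \<omega> = Inf (enat ` {t. X t \<omega> = a})"

definition strong_stationary_link ::
    "'s set \<Rightarrow> ('s \<Rightarrow> real) \<Rightarrow> ('s \<Rightarrow> 's \<Rightarrow> real) \<Rightarrow> ('s \<Rightarrow> real) \<Rightarrow>
     't set \<Rightarrow> ('t \<Rightarrow> real) \<Rightarrow> ('t \<Rightarrow> 't \<Rightarrow> real) \<Rightarrow> 't \<Rightarrow> ('t \<Rightarrow> 's \<Rightarrow> real) \<Rightarrow> bool" where
  "strong_stationary_link E \<nu> P \<pi> E' \<nu>' P' a \<Lambda> \<longleftrightarrow>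
     stochastic_kernel E' E \<Lambda> \<and>
     (\<forall>e\<in>E. \<Lambda> a e = \<pi> e) \<and>
     (\<forall>e\<in>E. \<nu> e = vec_mult E' \<nu>' \<Lambda> e) \<and>
     (\<forall>e'\<in>E'. \<forall>e\<in>E. mat_mult E \<Lambda> P e' e = mat_mult E' P' \<Lambda> e' e)"

text \<open>
  The process \<open>X'\<close> on \<open>M\<close>, with state space \<open>E'\<close>, initial distribution \<open>\<nu>'\<close>, transition matrix \<open>P'\<close>
  and absorbing state \<open>a\<close>, is a strong stationary dual of the ergodic chain with state space \<open>E\<close>,
  initial distribution \<open>\<nu>\<close>, transition matrix \<open>P\<close> and stationary distribution \<open>\<pi>\<close>.
\<close>

definition strong_stationary_dual ::
    "'s set \<Rightarrow> ('s \<Rightarrow> real) \<Rightarrow> ('s \<Rightarrow> 's \<Rightarrow> real) \<Rightarrow> ('s \<Rightarrow> real) \<Rightarrow>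
     'w measure \<Rightarrow> (nat \<Rightarrow> 'w \<Rightarrow> 't) \<Rightarrow>
     't set \<Rightarrow> ('t \<Rightarrow> real) \<Rightarrow> ('t \<Rightarrow> 't \<Rightarrow> real) \<Rightarrow> 't \<Rightarrow> bool" where
  "strong_stationary_dual E \<nu> P \<pi> M X' E' \<nu>' P' a \<longleftrightarrow>
     ergodic_chain E \<nu> P \<pi> \<and>
     markov_chain M X' E' \<nu>' P' \<and>
     a \<in> E' \<and> P' a a = 1 \<and>
     (\<exists>\<Lambda>. strong_stationary_link E \<nu> P \<pi> E' \<nu>' P' a \<Lambda>)"

definition sharp_strong_stationary_dual ::
    "'s set \<Rightarrow> ('s \<Rightarrow> real) \<Rightarrow> ('s \<Rightarrow> 's \<Rightarrow> real) \<Rightarrow> ('s \<Rightarrow> real) \<Rightarrow>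
     'w measure \<Rightarrow> (nat \<Rightarrow> 'w \<Rightarrow> 't) \<Rightarrow>
     't set \<Rightarrow> ('t \<Rightarrow> real) \<Rightarrow> ('t \<Rightarrow> 't \<Rightarrow> real) \<Rightarrow> 't \<Rightarrow> bool" where
  "sharp_strong_stationary_dual E \<nu> P \<pi> M X' E' \<nu>' P' a \<longleftrightarrow>
     strong_stationary_dual E \<nu> P \<pi> M X' E' \<nu>' P' a \<and>
     (\<forall>m. separation E (vec_mult E \<nu> (mat_power E P m)) \<pi> =
          \<P>(\<omega> in M. enat m < absorption_time X' a \<omega>))"

definition uniform :: "'s set \<Rightarrow> 's \<Rightarrow> real" where
  "uniform E e = 1 / real (card E)"

text \<open>
  \<open>{0, \<dots>, k}\<^sup>n\<close> is rendered by the extensional functions on \<open>{1..n}\<close>, so that equality of states is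
  equality of all \<open>n\<close> coordinates.
\<close>

definition cube :: "nat \<Rightarrow> nat \<Rightarrow> (nat \<Rightarrow> nat) set" where
  "cube n k = PiE {1..n} (\<lambda>_. {0..k})"

definition const_state :: "nat \<Rightarrow> nat \<Rightarrow> nat \<Rightarrow> nat" where
  "const_state n c = (\<lambda>i\<in>{1..n}. c)"

definition corner :: "nat \<Rightarrow> nat \<Rightarrow> nat set \<Rightarrow> nat \<Rightarrow> nat" where
  "corner n k A = (\<lambda>i\<in>{1..n}. if i \<in> A then k else 0)"

definition cube_walk :: "nat \<Rightarrow> nat \<Rightarrow> (nat \<Rightarrow> nat) \<Rightarrow> (nat \<Rightarrow> nat) \<Rightarrow> real" where
  "cube_walk n k e e' =
     (if e = e' then 1 / 2
      else if \<exists>i\<in>{1..n}. e i \<noteq> e' i \<and> (\<forall>j\<in>{1..n} - {i}. e j = e' j) then 1 / (2 * real n * real k)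
      else 0)"

end

theory Submission
  imports Defs
begin

text \<open>
  A step of the walk can be realised as follows: with probability \<open>q = (k + 1) / (2 k)\<close> choose a
  coordinate uniformly and replace its value by a uniform element of \<open>{0..k}\<close>, otherwise do nothing
  (\<open>cube_walk_eq\<close>). Once a coordinate has been refreshed it stays uniform and independent of the
  others, while a coordinate never refreshed keeps its initial value. So the set of refreshed
  coordinates contains all the information about how far the walk is from uniformity, and the dual
  records it: its state \<open>d\<close> has \<open>d i = k\<close> when coordinate \<open>i\<close> has been refreshed, and
  a refresh of coordinate \<open>i\<close> raises \<open>d i\<close> to \<open>k\<close>.

  The link \<open>\<Lambda> d\<close> makes the coordinates with \<open>d i = k\<close> independent and uniform and fixes the others at
  \<open>d i\<close>. Refreshing coordinate \<open>i\<close> under \<open>\<Lambda> d\<close> gives \<open>\<Lambda> (d(i := k))\<close>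
  (\<open>partial_uniform_average\<close>); averaging over \<open>i\<close> yields \<open>\<Lambda> P = P' \<Lambda>\<close>. This holds for
  every \<open>d\<close> in the cube and not only for corners, so the same formula defines the dual on the
  whole state space. From the corner of \<open>A\<close> the dual moves to that of \<open>A \<union> {j}\<close> with probability \<open>q / n\<close>,
  and it is absorbed at the top corner, whose link is the uniform law.

  Sharpness comes from looking at the state \<open>(k, \<dots>, k)\<close>: any \<open>d\<close> other than the top corner has a
  coordinate fixed at a value below \<open>k\<close>, so \<open>\<Lambda> d\<close> gives this state no mass. The walk is there
  at time \<open>m\<close> with probability exactly \<open>\<P>(T \<le> m)\<close> times the stationary one, and at every other state
  with at least that (\<open>separation_eq_unabsorbed_mass\<close>, \<open>absorption_time_tail\<close>).

  The dual process itself is obtained by applying an independent random update at each time, on the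
  infinite product space of the updates (\<open>markov_chain_driven\<close>).
\<close>

section \<open>Laws of a chain and of its dual\<close>

lemma prob_vector_point_mass:
  "finite E \<Longrightarrow> x \<in> E \<Longrightarrow> prob_vector E (point_mass x)"
  by (simp add: prob_vector_def point_mass_def)

lemma sum_point_mass: "finite E \<Longrightarrow> a \<in> E \<Longrightarrow> (\<Sum>e\<in>E. point_mass a e * h e) = h a"
  by (simp add: point_mass_def if_distrib[of "\<lambda>x. x * _"] cong: if_cong)

lemma vec_mult_power_0:
  assumes "finite E" "e \<in> E"
  shows "vec_mult E \<nu> (mat_power E P 0) e = \<nu> e"
  using assms by (simp add: vec_mult_def point_mass_def if_distrib[of "(*) _"] cong: if_cong)

lemma vec_mult_power_Suc:
  "vec_mult E \<nu> (mat_power E P (Suc m)) f = (\<Sum>g\<in>E. vec_mult E \<nu> (mat_power E P m) g * P g f)"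
  unfolding vec_mult_def mat_power.simps mat_mult_def sum_distrib_left sum_distrib_right
  by (subst sum.swap) (simp add: mult.assoc)

lemma vec_mult_power_nonneg:
  assumes "prob_vector E \<nu>" "stochastic_kernel E E P" "f \<in> E" "finite E"
  shows "0 \<le> vec_mult E \<nu> (mat_power E P m) f"
  using assms(3)
proof (induction m arbitrary: f)
  case 0
  then show ?case
    using assms vec_mult_power_0[of E f \<nu> P] by (simp add: prob_vector_def)
next
  case (Suc m)
  then show ?case unfolding vec_mult_power_Suc
    using assms by (intro sum_nonneg mult_nonneg_nonneg) (auto simp: stochastic_kernel_def prob_vector_def)
qed

text \<open>
  Since \<open>\<Lambda> P = P' \<Lambda>\<close>, one step of the original chain after the link is the link after one step of
  the dual; induction turns this into \<open>\<nu> P\<^sup>m = \<nu>' P'\<^sup>m \<Lambda>\<close>.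
\<close>

lemma link_transports_law:
  assumes link: "strong_stationary_link E \<nu> P \<pi> E' \<nu>' P' a \<Lambda>"
    and fin: "finite E" "finite E'" and "e \<in> E"
  shows "vec_mult E \<nu> (mat_power E P m) e
           = (\<Sum>d\<in>E'. vec_mult E' \<nu>' (mat_power E' P' m) d * \<Lambda> d e)"
  using \<open>e \<in> E\<close>
proof (induction m arbitrary: e)
  case 0
  have "vec_mult E \<nu> (mat_power E P 0) e = vec_mult E' \<nu>' \<Lambda> e"
    using link 0 vec_mult_power_0[OF fin(1) 0] by (simp add: strong_stationary_link_def)
  also have "\<dots> = (\<Sum>d\<in>E'. vec_mult E' \<nu>' (mat_power E' P' 0) d * \<Lambda> d e)"
    unfolding vec_mult_def[of E' \<nu>' \<Lambda>] using fin(2)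
    by (intro sum.cong refl) (simp only: vec_mult_power_0)
  finally show ?case .
next
  case (Suc m)
  let ?\<mu> = "vec_mult E' \<nu>' (mat_power E' P' m)"
  have "vec_mult E \<nu> (mat_power E P (Suc m)) e = (\<Sum>g\<in>E. (\<Sum>d\<in>E'. ?\<mu> d * \<Lambda> d g) * P g e)"
    unfolding vec_mult_power_Suc by (intro sum.cong refl) (simp add: Suc.IH)
  also have "\<dots> = (\<Sum>d\<in>E'. ?\<mu> d * mat_mult E \<Lambda> P d e)"
    unfolding mat_mult_def sum_distrib_left sum_distrib_right
    by (subst sum.swap) (simp add: mult.assoc)
  also have "\<dots> = (\<Sum>d\<in>E'. ?\<mu> d * mat_mult E' P' \<Lambda> d e)"
    using link Suc.prems by (intro sum.cong refl) (simp add: strong_stationary_link_def)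
  also have "\<dots> = (\<Sum>f\<in>E'. (\<Sum>d\<in>E'. ?\<mu> d * P' d f) * \<Lambda> f e)"
    unfolding mat_mult_def sum_distrib_left sum_distrib_right
    by (subst sum.swap) (simp add: mult.assoc)
  finally show ?case unfolding vec_mult_power_Suc .
qed

text \<open>
  The criterion for sharpness. By \<open>link_transports_law\<close>, \<open>\<nu> P\<^sup>m\<close> contains the mass that the dual has at
  \<open>a\<close> times \<open>\<pi>\<close>, so no ratio \<open>\<nu> P\<^sup>m(e) / \<pi>(e)\<close> is below that mass. The other dual states contribute
  nothing at the state \<open>b\<close>, so the ratio attains the bound there.
\<close>

lemma separation_eq_unabsorbed_mass:
  assumes link: "strong_stationary_link E \<nu> P \<pi> E' \<nu>' P' a \<Lambda>"
    and fin: "finite E" "finite E'"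
    and pos: "\<And>e. e \<in> E \<Longrightarrow> 0 < \<pi> e"
    and dual: "prob_vector E' \<nu>'" "stochastic_kernel E' E' P'"
    and "a \<in> E'" and "b \<in> E" and b: "\<And>d. d \<in> E' \<Longrightarrow> d \<noteq> a \<Longrightarrow> \<Lambda> d b = 0"
  shows "separation E (vec_mult E \<nu> (mat_power E P m)) \<pi>
           = 1 - vec_mult E' \<nu>' (mat_power E' P' m) a"
proof -
  let ?\<mu> = "vec_mult E' \<nu>' (mat_power E' P' m)"
  have \<Lambda>a: "\<Lambda> a e = \<pi> e" if "e \<in> E" for e
    using link that by (simp add: strong_stationary_link_def)
  have split: "vec_mult E \<nu> (mat_power E P m) e = ?\<mu> a * \<pi> e + (\<Sum>d\<in>E'-{a}. ?\<mu> d * \<Lambda> d e)"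
    if "e \<in> E" for e
    using link_transports_law[OF link fin that, of m]
      sum.remove[OF fin(2) \<open>a \<in> E'\<close>, of "\<lambda>d. ?\<mu> d * \<Lambda> d e"] \<Lambda>a[OF that]
    by (simp only:)
  have "Max ((\<lambda>e. 1 - vec_mult E \<nu> (mat_power E P m) e / \<pi> e) ` E) = 1 - ?\<mu> a"
  proof (rule Max_eqI)
    show "finite ((\<lambda>e. 1 - vec_mult E \<nu> (mat_power E P m) e / \<pi> e) ` E)"
      using fin by simp
    show "y \<le> 1 - ?\<mu> a"
      if y: "y \<in> (\<lambda>e. 1 - vec_mult E \<nu> (mat_power E P m) e / \<pi> e) ` E" for y
    proof -
      obtain e where e: "e \<in> E" "y = 1 - vec_mult E \<nu> (mat_power E P m) e / \<pi> e"
        using y by blast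
      have "0 \<le> (\<Sum>d\<in>E'-{a}. ?\<mu> d * \<Lambda> d e)"
        using link e(1) vec_mult_power_nonneg[OF dual _ fin(2)]
        by (intro sum_nonneg mult_nonneg_nonneg)
           (auto simp: strong_stationary_link_def stochastic_kernel_def prob_vector_def)
      then have "?\<mu> a * \<pi> e \<le> vec_mult E \<nu> (mat_power E P m) e"
        using split[OF e(1)] by simp
      then have "?\<mu> a \<le> vec_mult E \<nu> (mat_power E P m) e / \<pi> e"
        using pos[OF e(1)] by (simp add: pos_le_divide_eq)
      then show ?thesis using e(2) by simp
    qed
    have "vec_mult E \<nu> (mat_power E P m) b = ?\<mu> a * \<pi> b"
      using split[OF \<open>b \<in> E\<close>] b by simp
    then show "1 - ?\<mu> a \<in> (\<lambda>e. 1 - vec_mult E \<nu> (mat_power E P m) e / \<pi> e) ` E"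
      using \<open>b \<in> E\<close> pos[OF \<open>b \<in> E\<close>] by (intro image_eqI[of _ _ b]) auto
  qed
  then show ?thesis unfolding separation_def .
qed

section \<open>Time-homogeneous Markov processes\<close>

text \<open>
  The Markov property conditions on the whole history. Summing it over the finitely many histories
  that end in \<open>e\<close> gives the same transition probability conditionally on the present state alone.
\<close>

lemma markov_chain_two_step_law:
  assumes mc: "markov_chain M X E \<nu> P" and "e \<in> E" "f \<in> E"
  shows "\<P>(\<omega> in M. X t \<omega> = e \<and> X (Suc t) \<omega> = f) = \<P>(\<omega> in M. X t \<omega> = e) * P e f"
proof -
  interpret prob_space M using mc by (simp add: markov_chain_def)
  have X [measurable]: "X s \<in> M \<rightarrow>\<^sub>M count_space E" for s
    using mc by (simp add: markov_chain_def)
  have "finite E" using mc by (simp add: markov_chain_def)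
  have XE: "X s \<omega> \<in> E" if "\<omega> \<in> space M" for s \<omega>
    using measurable_space[OF X that] by simp
  define H where "H = {h \<in> {..t} \<rightarrow>\<^sub>E E. h t = e}"
  have finH: "finite H"
    unfolding H_def using \<open>finite E\<close> by (auto intro!: finite_subset[OF _ finite_PiE[of "{..t}" "\<lambda>_. E"]])
  have hist_meas: "{\<omega> \<in> space M. \<forall>s\<le>t. X s \<omega> = h s} \<in> events" if "h \<in> H" for h
  proof -
    have "\<And>s. s \<le> t \<Longrightarrow> {h s} \<in> sets (count_space E)" using that by (auto simp: H_def)
    then have "\<And>s. s \<in> {..t} \<Longrightarrow> {\<omega> \<in> space M. X s \<omega> = h s} \<in> events"
      by (intro measurable_sets_Collect[OF X]) auto
    then have "{\<omega> \<in> space M. \<forall>s\<in>{..t}. X s \<omega> = h s} \<in> events"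
      by (intro sets.sets_Collect_finite_All') auto
    then show ?thesis by simp
  qed
  \<comment> \<open>With \<open>Q\<close> fixing the next state, and with \<open>Q\<close> true, the sums compare term by term.\<close>
  have by_history: "\<P>(\<omega> in M. X t \<omega> = e \<and> Q \<omega>) = (\<Sum>h\<in>H. \<P>(\<omega> in M. Q \<omega> \<and> (\<forall>s\<le>t. X s \<omega> = h s)))"
    if Q: "{\<omega> \<in> space M. Q \<omega>} \<in> events" for Q
  proof -
    let ?S = "\<lambda>h. {\<omega> \<in> space M. Q \<omega> \<and> (\<forall>s\<le>t. X s \<omega> = h s)}"
    have cover: "{\<omega> \<in> space M. X t \<omega> = e \<and> Q \<omega>} = (\<Union>h\<in>H. ?S h)"
    proof (intro equalityI subsetI)
      fix \<omega> assume \<omega>: "\<omega> \<in> {\<omega> \<in> space M. X t \<omega> = e \<and> Q \<omega>}"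
      then have "(\<lambda>s\<in>{..t}. X s \<omega>) \<in> H" using XE by (auto simp: H_def)
      moreover have "\<omega> \<in> ?S (\<lambda>s\<in>{..t}. X s \<omega>)" using \<omega> by auto
      ultimately show "\<omega> \<in> (\<Union>h\<in>H. ?S h)" by blast
    next
      fix \<omega> assume "\<omega> \<in> (\<Union>h\<in>H. ?S h)"
      then obtain h where "h \<in> H" "\<omega> \<in> space M" "Q \<omega>" "\<forall>s\<le>t. X s \<omega> = h s" by blast
      then show "\<omega> \<in> {\<omega> \<in> space M. X t \<omega> = e \<and> Q \<omega>}" by (simp add: H_def)
    qed
    have "?S h = {\<omega> \<in> space M. Q \<omega>} \<inter> {\<omega> \<in> space M. \<forall>s\<le>t. X s \<omega> = h s}" for h by auto
    then have "?S ` H \<subseteq> events"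
      using sets.Int[OF Q hist_meas] by auto
    moreover have "disjoint_family_on ?S H"
    proof (unfold disjoint_family_on_def, intro ballI impI)
      fix h h' assume hh: "h \<in> H" "h' \<in> H" "h \<noteq> h'"
      then have "\<exists>s\<le>t. h s \<noteq> h' s"
        unfolding H_def by (metis (no_types, lifting) PiE_ext atMost_iff mem_Collect_eq)
      then show "?S h \<inter> ?S h' = {}" by force
    qed
    ultimately show ?thesis
      unfolding cover by (intro finite_measure_finite_Union[OF finH])
  qed
  have one_history: "\<P>(\<omega> in M. X (Suc t) \<omega> = f \<and> (\<forall>s\<le>t. X s \<omega> = h s))
      = \<P>(\<omega> in M. \<forall>s\<le>t. X s \<omega> = h s) * P e f" if "h \<in> H" for h
  proof (cases "\<P>(\<omega> in M. \<forall>s\<le>t. X s \<omega> = h s) = 0")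
    case True
    have "\<P>(\<omega> in M. X (Suc t) \<omega> = f \<and> (\<forall>s\<le>t. X s \<omega> = h s)) \<le> \<P>(\<omega> in M. \<forall>s\<le>t. X s \<omega> = h s)"
      using hist_meas[OF that] by (intro finite_measure_mono) auto
    then show ?thesis using True by (simp add: measure_le_0_iff)
  next
    case False
    let ?x = "h(Suc t := f)"
    have same: "(\<forall>s\<le>t. X s \<omega> = ?x s) = (\<forall>s\<le>t. X s \<omega> = h s)" for \<omega> by auto
    have "\<forall>s\<le>Suc t. ?x s \<in> E" using that \<open>f \<in> E\<close> by (auto simp: H_def)
    moreover have "\<P>(\<omega> in M. \<forall>s\<le>t. X s \<omega> = ?x s) > 0"
      using False unfolding same by (simp add: zero_less_measure_iff)
    ultimately have "\<P>(\<omega> in M. X (Suc t) \<omega> = ?x (Suc t) \<bar> \<forall>s\<le>t. X s \<omega> = ?x s) = P (?x t) (?x (Suc t))"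
      using mc unfolding markov_chain_def by blast
    then have "\<P>(\<omega> in M. X (Suc t) \<omega> = f \<bar> \<forall>s\<le>t. X s \<omega> = h s) = P e f"
      unfolding same using that by (simp add: H_def)
    then show ?thesis using False by (simp add: cond_prob_def field_simps)
  qed
  have Xf: "{\<omega> \<in> space M. X (Suc t) \<omega> = f} \<in> events"
    using \<open>f \<in> E\<close> by (intro measurable_sets_Collect[OF X]) auto
  show ?thesis
    using by_history[OF Xf] by_history[of "\<lambda>_. True"] one_history by (simp add: sum_distrib_right)
qed

lemma markov_chain_law:
  assumes mc: "markov_chain M X E \<nu> P" and "f \<in> E"
  shows "\<P>(\<omega> in M. X t \<omega> = f) = vec_mult E \<nu> (mat_power E P t) f"
  using \<open>f \<in> E\<close>
proof (induction t arbitrary: f)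
  case 0
  then show ?case
    using mc vec_mult_power_0[of E f \<nu> P] by (simp add: markov_chain_def)
next
  case (Suc t)
  interpret prob_space M using mc by (simp add: markov_chain_def)
  have X [measurable]: "X s \<in> M \<rightarrow>\<^sub>M count_space E" for s
    using mc by (simp add: markov_chain_def)
  have "finite E" using mc by (simp add: markov_chain_def)
  have Xm: "{\<omega> \<in> space M. X s \<omega> = e} \<in> events" if "e \<in> E" for s e
    using that by (intro measurable_sets_Collect[OF X]) auto
  have "{\<omega> \<in> space M. X (Suc t) \<omega> = f} = (\<Union>e\<in>E. {\<omega> \<in> space M. X t \<omega> = e \<and> X (Suc t) \<omega> = f})"
    using measurable_space[OF X] by auto
  also have "prob \<dots> = (\<Sum>e\<in>E. \<P>(\<omega> in M. X t \<omega> = e \<and> X (Suc t) \<omega> = f))"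
  proof (rule finite_measure_finite_Union[OF \<open>finite E\<close>])
    have "{\<omega> \<in> space M. X t \<omega> = e \<and> X (Suc t) \<omega> = f}
        = {\<omega> \<in> space M. X t \<omega> = e} \<inter> {\<omega> \<in> space M. X (Suc t) \<omega> = f}" for e by auto
    then show "(\<lambda>e. {\<omega> \<in> space M. X t \<omega> = e \<and> X (Suc t) \<omega> = f}) ` E \<subseteq> events"
      using sets.Int[OF Xm Xm[OF Suc.prems]] by auto
  qed (auto simp: disjoint_family_on_def)
  also have "\<dots> = (\<Sum>e\<in>E. vec_mult E \<nu> (mat_power E P t) e * P e f)"
    using markov_chain_two_step_law[OF mc _ Suc.prems] Suc.IH by (intro sum.cong) auto
  finally show ?case unfolding vec_mult_power_Suc .
qed

lemma less_absorption_time_iff: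
  "enat m < absorption_time X a \<omega> \<longleftrightarrow> (\<forall>t\<le>m. X t \<omega> \<noteq> a)"
proof
  assume "enat m < absorption_time X a \<omega>"
  moreover have "absorption_time X a \<omega> \<le> enat t" if "X t \<omega> = a" for t
    unfolding absorption_time_def using that by (intro Inf_lower) simp
  ultimately have "enat m < enat t" if "X t \<omega> = a" for t
    using that less_le_trans by blast
  then show "\<forall>t\<le>m. X t \<omega> \<noteq> a" by (metis enat_ord_simps(2) not_less)
next
  assume *: "\<forall>t\<le>m. X t \<omega> \<noteq> a"
  have "enat (Suc m) \<le> absorption_time X a \<omega>"
    unfolding absorption_time_def using * by (intro Inf_greatest) (auto simp: not_less_eq_eq)
  then show "enat m < absorption_time X a \<omega>"
    by (rule less_le_trans[rotated]) simp
qed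

text \<open>
  The absorbing state is almost surely never left, as a step out of it has probability \<open>0\<close>.
  Hence, almost surely, absorption by time \<open>m\<close> means being at \<open>a\<close> at time \<open>m\<close>.
\<close>

lemma absorption_time_tail:
  assumes mc: "markov_chain M X E \<nu> P" and "a \<in> E" and "P a a = 1"
  shows "\<P>(\<omega> in M. enat m < absorption_time X a \<omega>) = 1 - vec_mult E \<nu> (mat_power E P m) a"
proof -
  interpret prob_space M using mc by (simp add: markov_chain_def)
  have X [measurable]: "X s \<in> M \<rightarrow>\<^sub>M count_space E" for s
    using mc by (simp add: markov_chain_def)
  have Xa: "{\<omega> \<in> space M. X s \<omega> = a} \<in> events" for s
    using \<open>a \<in> E\<close> by (intro measurable_sets_Collect[OF X]) auto
  have "AE \<omega> in M. X t \<omega> = a \<longrightarrow> X (Suc t) \<omega> = a" for t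
  proof -
    let ?A = "{\<omega> \<in> space M. X t \<omega> = a}" and ?B = "{\<omega> \<in> space M. X (Suc t) \<omega> = a}"
    have "?A \<inter> ?B = {\<omega> \<in> space M. X t \<omega> = a \<and> X (Suc t) \<omega> = a}" by auto
    then have "prob (?A \<inter> ?B) = prob ?A"
      using markov_chain_two_step_law[OF mc \<open>a \<in> E\<close> \<open>a \<in> E\<close>] \<open>P a a = 1\<close> by simp
    then have "prob (?A - ?B) = 0"
      using finite_measure_Diff'[OF Xa Xa] by simp
    then have "?A - ?B \<in> null_sets M"
      using Xa by (simp add: null_sets_def emeasure_eq_measure sets.Diff)
    then show ?thesis by (rule AE_I') auto
  qed
  then have AE: "AE \<omega> in M. \<forall>t. X t \<omega> = a \<longrightarrow> X (Suc t) \<omega> = a"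
    by (simp add: AE_all_countable)
  have tail: "{\<omega> \<in> space M. \<forall>t\<le>m. X t \<omega> \<noteq> a} \<in> events"
  proof -
    have "{\<omega> \<in> space M. \<forall>t\<in>{..m}. \<not> X t \<omega> = a} \<in> events"
      using Xa by (intro sets.sets_Collect_finite_All' sets.sets_Collect_neg) auto
    then show ?thesis by simp
  qed
  have "\<P>(\<omega> in M. enat m < absorption_time X a \<omega>) = \<P>(\<omega> in M. \<forall>t\<le>m. X t \<omega> \<noteq> a)"
    by (simp add: less_absorption_time_iff)
  also have "\<dots> = \<P>(\<omega> in M. \<not> X m \<omega> = a)"
  proof (rule finite_measure_eq_AE[OF _ tail])
    show "AE \<omega> in M. (\<omega> \<in> {\<omega> \<in> space M. \<forall>t\<le>m. X t \<omega> \<noteq> a})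
        = (\<omega> \<in> {\<omega> \<in> space M. X m \<omega> \<noteq> a})"
      using AE
    proof eventually_elim
      case (elim \<omega>)
      have "X m \<omega> = a" if "X t \<omega> = a" "t \<le> m" for t
        using that(2) by (induction rule: dec_induct) (use that elim in auto)
      then show ?case by auto
    qed
  qed (use sets.sets_Collect_neg[OF Xa] in simp)
  also have "\<dots> = 1 - \<P>(\<omega> in M. X m \<omega> = a)"
    by (rule prob_neg[OF Xa])
  finally show ?thesis by (simp only: markov_chain_law[OF mc \<open>a \<in> E\<close>])
qed

section \<open>Markov chains driven by independent updates\<close>

primrec driven_chain :: "('r \<Rightarrow> 's \<Rightarrow> 's) \<Rightarrow> 's \<Rightarrow> nat \<Rightarrow> (nat \<Rightarrow> 'r) \<Rightarrow> 's" where
  "driven_chain F x0 0 \<omega> = x0"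
| "driven_chain F x0 (Suc t) \<omega> = F (\<omega> t) (driven_chain F x0 t \<omega>)"

text \<open>
  Prescribing the path up to time \<open>t\<close> amounts to one condition on each of the first \<open>t\<close> updates
  separately. This makes path probabilities products when the updates are independent.
\<close>

lemma driven_chain_path_iff:
  "(\<forall>s\<le>t. driven_chain F x0 s \<omega> = x s) \<longleftrightarrow> x 0 = x0 \<and> (\<forall>s<t. F (\<omega> s) (x s) = x (Suc s))"
  by (induction t) (auto simp: le_Suc_eq less_Suc_eq all_conj_distrib)

lemma prob_vector_pmf:
  assumes "finite E" "set_pmf p \<subseteq> E"
  shows "prob_vector E (pmf p)"
  using assms by (simp add: prob_vector_def sum_pmf_eq_1)

text \<open>
  The existence of the dual process: on the infinite product of copies of \<open>p\<close>, the path
  event is a cylinder, so its probability is a product of one-step probabilities, and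
  the conditional probability of the next state is a quotient of two such products.
\<close>

lemma markov_chain_driven:
  fixes p :: "'r pmf"
  assumes "finite E" "x0 \<in> E" and closed: "\<And>r e. e \<in> E \<Longrightarrow> F r e \<in> E"
  shows "markov_chain (PiM UNIV (\<lambda>_. measure_pmf p)) (driven_chain F x0) E (point_mass x0)
           (\<lambda>e. pmf (map_pmf (\<lambda>r. F r e) p))"
proof -
  define M where "M = PiM UNIV (\<lambda>_::nat. measure_pmf p)"
  define K where "K = (\<lambda>e. pmf (map_pmf (\<lambda>r. F r e) p))"
  interpret iid: product_prob_space "\<lambda>_::nat. measure_pmf p" UNIV
    by unfold_locales
  have psM: "prob_space M"
    unfolding M_def by (rule iid.prob_space_axioms)
  have spM: "space M = UNIV" by (simp add: M_def space_PiM)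
  have meas: "driven_chain F x0 t \<in> M \<rightarrow>\<^sub>M count_space E" for t
  proof (induction t)
    case 0
    then show ?case using \<open>x0 \<in> E\<close> by simp
  next
    case (Suc t)
    have "(\<lambda>\<omega>. F (\<omega> t) (driven_chain F x0 t \<omega>)) \<in> M \<rightarrow>\<^sub>M count_space E"
    proof (rule measurable_compose_countable'[OF _ Suc countable_finite[OF \<open>finite E\<close>]])
      fix e assume "e \<in> E"
      have "(\<lambda>\<omega>. \<omega> t) \<in> M \<rightarrow>\<^sub>M measure_pmf p" unfolding M_def by simp
      moreover have "(\<lambda>r. F r e) \<in> measure_pmf p \<rightarrow>\<^sub>M count_space E"
        using closed[OF \<open>e \<in> E\<close>] by simp
      ultimately show "(\<lambda>\<omega>. F (\<omega> t) e) \<in> M \<rightarrow>\<^sub>M count_space E"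
        by (rule measurable_compose)
    qed
    then show ?case by simp
  qed
  have path: "\<P>(\<omega> in M. \<forall>s\<le>t. driven_chain F x0 s \<omega> = x s)
      = (if x 0 = x0 then \<Prod>s<t. K (x s) (x (Suc s)) else 0)" for t x
  proof (cases "x 0 = x0")
    case True
    let ?B = "\<lambda>s. {r. F r (x s) = x (Suc s)}"
    have "{\<omega> \<in> space M. \<forall>s\<le>t. driven_chain F x0 s \<omega> = x s}
        = prod_emb UNIV (\<lambda>_. measure_pmf p) {..<t} (PiE {..<t} ?B)"
      unfolding driven_chain_path_iff spM prod_emb_def vimage_def restrict_PiE_iff
      by (simp add: True PiE_UNIV_domain Ball_def)
    then have "measure M {\<omega> \<in> space M. \<forall>s\<le>t. driven_chain F x0 s \<omega> = x s}
        = (\<Prod>s<t. measure (measure_pmf p) (?B s))"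
      unfolding M_def by (simp add: iid.measure_PiM_emb)
    also have "\<dots> = (\<Prod>s<t. K (x s) (x (Suc s)))"
      by (simp add: K_def pmf_map vimage_def)
    finally show ?thesis using True by simp
  qed (auto simp: driven_chain_path_iff)
  have "\<P>(\<omega> in M. driven_chain F x0 (Suc t) \<omega> = x (Suc t) \<bar> \<forall>s\<le>t. driven_chain F x0 s \<omega> = x s)
      = K (x t) (x (Suc t))"
    if "\<P>(\<omega> in M. \<forall>s\<le>t. driven_chain F x0 s \<omega> = x s) > 0" for t x
  proof -
    have extend: "(driven_chain F x0 (Suc t) \<omega> = x (Suc t) \<and> (\<forall>s\<le>t. driven_chain F x0 s \<omega> = x s))
        = (\<forall>s\<le>Suc t. driven_chain F x0 s \<omega> = x s)" for \<omega>
      by (auto simp: le_Suc_eq)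
    have "x 0 = x0" "(\<Prod>s<t. K (x s) (x (Suc s))) \<noteq> 0"
      using that unfolding path by (auto split: if_split_asm simp del: prod_zero_iff)
    then show ?thesis
      unfolding cond_prob_def extend path by (simp del: prod_zero_iff)
  qed
  moreover have "\<P>(\<omega> in M. driven_chain F x0 0 \<omega> = e) = point_mass x0 e" for e
    using path[of 0 "\<lambda>_. e"] by (simp add: point_mass_def prob_space.prob_space[OF psM])
  moreover have "stochastic_kernel E E K"
    unfolding stochastic_kernel_def K_def
    using assms(1) closed by (auto intro!: prob_vector_pmf)
  moreover have "prob_vector E (point_mass x0)"
    using assms by (intro prob_vector_point_mass)
  ultimately have "markov_chain M (driven_chain F x0) E (point_mass x0) K"
    unfolding markov_chain_def using psM \<open>finite E\<close> meas by blast
  then show ?thesis unfolding M_def K_def .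
qed

section \<open>States of the cube\<close>

lemma finite_cube: "finite (cube n k)"
  by (simp add: cube_def finite_PiE)

lemma fun_upd_cube: "e \<in> cube n k \<Longrightarrow> i \<in> {1..n} \<Longrightarrow> c \<le> k \<Longrightarrow> e(i := c) \<in> cube n k"
  by (auto simp: cube_def PiE_iff extensional_def)

lemma corner_in_cube: "corner n k A \<in> cube n k"
  by (auto simp: cube_def corner_def)

lemma const_state_in_cube: "c \<le> k \<Longrightarrow> const_state n c \<in> cube n k"
  by (auto simp: cube_def const_state_def)

lemma cube_eqI:
  assumes "e \<in> cube n k" "f \<in> cube n k" "\<And>i. i \<in> {1..n} \<Longrightarrow> e i = f i"
  shows "e = f"
  using assms unfolding cube_def by (rule PiE_ext)

lemma corner_eq_iff:
  assumes "k \<ge> 1" "A \<subseteq> {1..n}" "B \<subseteq> {1..n}"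
  shows "corner n k A = corner n k B \<longleftrightarrow> A = B"
proof
  assume eq: "corner n k A = corner n k B"
  have "i \<in> A \<longleftrightarrow> i \<in> B" if "i \<in> {1..n}" for i
    using fun_cong[OF eq, of i] that assms(1) by (auto simp: corner_def split: if_splits)
  then show "A = B" using assms by blast
qed simp

lemma corner_fun_upd: "i \<in> {1..n} \<Longrightarrow> (corner n k A)(i := k) = corner n k (A \<union> {i})"
  by (auto simp: corner_def fun_eq_iff)

lemma const_state_top: "const_state n k = corner n k {1..n}"
  by (auto simp: const_state_def corner_def fun_eq_iff)

lemma card_cube: "card (cube n k) = (k + 1) ^ n"
  by (simp add: cube_def card_PiE)

section \<open>The walk as random refreshing of coordinates\<close>

text \<open>
  Choosing a new value uniformly among all \<open>k + 1\<close> values, instead of among the \<open>k\<close> other ones,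
  changes the coordinate only with probability \<open>k / (k + 1)\<close>. A step of the walk changes the state with
  probability \<open>1/2\<close>, so a coordinate has to be refreshed with probability \<open>(k + 1) / (2 k)\<close>. For
  \<open>k \<ge> 1\<close> this is at most \<open>1\<close>.
\<close>

definition refresh_prob :: "nat \<Rightarrow> real" where
  "refresh_prob k = (real k + 1) / (2 * real k)"

text \<open>
  Refreshing coordinate \<open>i\<close> of \<open>f\<close> can produce \<open>e\<close> only if they agree elsewhere, and then for
  exactly one new value.
\<close>

lemma sum_point_mass_fun_upd:
  assumes "e \<in> cube n k" "f \<in> cube n k" "i \<in> {1..n}"
  shows "(\<Sum>c=0..k. point_mass (f(i := c)) e) = (if \<forall>j\<in>{1..n}-{i}. f j = e j then 1 else 0)"
proof -
  have "e = f(i := c) \<longleftrightarrow> (\<forall>j\<in>{1..n}-{i}. f j = e j) \<and> c = e i" if "c \<in> {0..k}" for c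
  proof
    assume *: "(\<forall>j\<in>{1..n}-{i}. f j = e j) \<and> c = e i"
    show "e = f(i := c)"
      by (rule cube_eqI[OF assms(1) fun_upd_cube[OF assms(2,3)]]) (use that * in auto)
  qed auto
  moreover have "e i \<in> {0..k}" using assms by (auto simp: cube_def)
  moreover have "(\<Sum>c=0..k. point_mass (f(i := c)) e)
      = (\<Sum>c=0..k. if (\<forall>j\<in>{1..n}-{i}. f j = e j) \<and> c = e i then 1 else 0)"
    unfolding point_mass_def using calculation(1) by (intro sum.cong) auto
  ultimately show ?thesis by (cases "\<forall>j\<in>{1..n}-{i}. f j = e j") (simp_all cong: conj_cong del: One_nat_def)
qed

text \<open>
  The decomposition of the walk: with probability \<open>1 - refresh_prob k\<close> nothing happens, otherwise a
  uniformly chosen coordinate is replaced by a uniform value. A refresh may draw the old value again,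
  which brings the probability of staying up to \<open>1/2\<close>.
\<close>

lemma cube_walk_eq:
  assumes "n \<ge> 1" "k \<ge> 1" "e \<in> cube n k" "f \<in> cube n k"
  shows "cube_walk n k f e = (1 - refresh_prob k) * point_mass f e
    + refresh_prob k / real n * (\<Sum>i=1..n. (\<Sum>c=0..k. point_mass (f(i := c)) e) / (real k + 1))"
proof -
  let ?agree = "\<lambda>i. \<forall>j\<in>{1..n}-{i}. f j = e j"
  have S: "(\<Sum>i=1..n. (\<Sum>c=0..k. point_mass (f(i := c)) e) / (real k + 1))
      = (\<Sum>i=1..n. if ?agree i then 1 else 0) / (real k + 1)"
    using sum_point_mass_fun_upd[OF assms(3,4)] by (simp add: sum_divide_distrib)
  consider (same) "f = e" | (nbr) i where "i \<in> {1..n}" "f i \<noteq> e i" "?agree i"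
    | (far) "f \<noteq> e" "\<not> (\<exists>i\<in>{1..n}. f i \<noteq> e i \<and> ?agree i)" by blast
  then show ?thesis
  proof cases
    case same
    then show ?thesis unfolding S using assms(1,2)
      by (simp add: cube_walk_def point_mass_def refresh_prob_def divide_simps)
  next
    case nbr
    then have "?agree j \<longleftrightarrow> j = i" if "j \<in> {1..n}" for j using that by auto
    then have "(\<Sum>j=1..n. if ?agree j then 1 else 0) = (\<Sum>j=1..n. if j = i then 1 else (0::real))"
      by (intro sum.cong) auto
    then have one: "(\<Sum>j=1..n. if ?agree j then 1 else 0) = (1::real)"
      using nbr(1) by simp
    have "f \<noteq> e" using nbr by auto
    moreover have "cube_walk n k f e = 1 / (2 * real n * real k)"
      using nbr \<open>f \<noteq> e\<close> by (auto simp: cube_walk_def)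
    ultimately show ?thesis unfolding S one using assms(1,2)
      by (simp add: point_mass_def refresh_prob_def)
  next
    case far
    have "\<not> ?agree i" if "i \<in> {1..n}" for i
      using far that cube_eqI[OF assms(4,3)] by blast
    then have zero: "(\<Sum>j=1..n. if ?agree j then 1 else 0) = (0::real)"
      by (intro sum.neutral) auto
    have "cube_walk n k f e = 0" using far unfolding cube_walk_def by (simp only: if_False)
    then show ?thesis unfolding S zero using far(1) by (simp add: point_mass_def)
  qed
qed

lemma cube_walk_sym: "cube_walk n k e f = cube_walk n k f e"
proof -
  have "(e = f) = (f = e)" "\<And>i. (e i \<noteq> f i) = (f i \<noteq> e i)" "\<And>j. (e j = f j) = (f j = e j)"
    by auto
  then show ?thesis unfolding cube_walk_def by presburger
qed

text \<open>
  By \<open>cube_walk_sym\<close> this computes \<open>P h\<close> and \<open>h P\<close> alike; the link identity is about the latter.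
\<close>

lemma cube_walk_action:
  assumes "n \<ge> 1" "k \<ge> 1" "f \<in> cube n k"
  shows "(\<Sum>e\<in>cube n k. cube_walk n k f e * h e) = (1 - refresh_prob k) * h f
    + refresh_prob k / real n * (\<Sum>i=1..n. (\<Sum>c=0..k. h (f(i := c))) / (real k + 1))"
proof -
  have "(\<Sum>e\<in>cube n k. cube_walk n k f e * h e)
      = (\<Sum>e\<in>cube n k. (1 - refresh_prob k) * (point_mass f e * h e) + refresh_prob k / real n *
          (\<Sum>i=1..n. (\<Sum>c=0..k. point_mass (f(i := c)) e * h e) / (real k + 1)))"
    by (intro sum.cong refl)
       (simp add: cube_walk_eq[OF assms(1,2) _ assms(3)] distrib_right sum_distrib_right mult.assoc)
  also have "\<dots> = (1 - refresh_prob k) * (\<Sum>e\<in>cube n k. point_mass f e * h e)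
      + refresh_prob k / real n * (\<Sum>e\<in>cube n k.
          \<Sum>i=1..n. (\<Sum>c=0..k. point_mass (f(i := c)) e * h e) / (real k + 1))"
    by (simp add: sum.distrib sum_distrib_left)
  also have "(\<Sum>e\<in>cube n k. \<Sum>i=1..n. (\<Sum>c=0..k. point_mass (f(i := c)) e * h e) / (real k + 1))
      = (\<Sum>i=1..n. (\<Sum>c=0..k. \<Sum>e\<in>cube n k. point_mass (f(i := c)) e * h e) / (real k + 1))"
    unfolding sum_divide_distrib
    by (subst sum.swap, intro sum.cong refl, subst sum.swap) simp
  finally show ?thesis
    using assms by (simp add: sum_point_mass finite_cube fun_upd_cube)
qed

section \<open>Ergodicity of the walk\<close>

lemma cube_walk_nonneg: "0 \<le> cube_walk n k e f"
  by (simp add: cube_walk_def)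

lemma cube_walk_stochastic:
  assumes "n \<ge> 1" "k \<ge> 1"
  shows "stochastic_kernel (cube n k) (cube n k) (cube_walk n k)"
  unfolding stochastic_kernel_def prob_vector_def
proof (intro ballI conjI cube_walk_nonneg)
  fix e assume "e \<in> cube n k"
  from cube_walk_action[OF assms this, of "\<lambda>_. 1"]
  show "(\<Sum>f\<in>cube n k. cube_walk n k e f) = 1" using assms by (simp add: add.commute)
qed

lemma cube_walk_stationary:
  assumes "n \<ge> 1" "k \<ge> 1"
  shows "stationary (cube n k) (cube_walk n k) (uniform (cube n k))"
  unfolding stationary_def
proof
  show "prob_vector (cube n k) (uniform (cube n k))"
    by (simp add: prob_vector_def uniform_def card_cube)
  show "\<forall>f\<in>cube n k. vec_mult (cube n k) (uniform (cube n k)) (cube_walk n k) f = uniform (cube n k) f"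
  proof
    fix f assume "f \<in> cube n k"
    then have "(\<Sum>e\<in>cube n k. cube_walk n k e f) = 1"
      using cube_walk_stochastic[OF assms]
      unfolding stochastic_kernel_def prob_vector_def by (subst cube_walk_sym) blast
    then show "vec_mult (cube n k) (uniform (cube n k)) (cube_walk n k) f = uniform (cube n k) f"
      by (simp add: vec_mult_def uniform_def sum_divide_distrib[symmetric])
  qed
qed

lemma mat_power_nonneg:
  assumes "\<And>e f. 0 \<le> P e f"
  shows "0 \<le> mat_power E P m e f"
  using assms by (induction m arbitrary: f) (auto simp: point_mass_def mat_mult_def intro!: sum_nonneg)

lemma mat_power_Suc_pos:
  assumes "finite E" "\<And>e f. 0 \<le> P e f" "g \<in> E" "mat_power E P m e g > 0" "P g f > 0"
  shows "mat_power E P (Suc m) e f > 0"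
proof -
  have "0 < mat_power E P m e g * P g f" using assms by simp
  also have "\<dots> \<le> (\<Sum>g\<in>E. mat_power E P m e g * P g f)"
    using assms by (intro member_le_sum mult_nonneg_nonneg mat_power_nonneg) auto
  finally show ?thesis by (simp add: mat_mult_def)
qed

text \<open>
  From \<open>e\<close> one reaches \<open>f\<close> by correcting one coordinate at a time; after the coordinates in
  \<open>S\<close> are corrected the state is \<open>override_on e f S\<close>.
\<close>

lemma cube_walk_irreducible:
  assumes "n \<ge> 1" "k \<ge> 1"
  shows "irreducible_chain (cube n k) (cube_walk n k)"
  unfolding irreducible_chain_def
proof (intro ballI)
  fix e f assume ef: "e \<in> cube n k" "f \<in> cube n k"
  have mix: "override_on e f S \<in> cube n k" if "S \<subseteq> {1..n}" for S
    using ef that by (auto simp: cube_def PiE_iff extensional_def override_on_def)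
  have "\<exists>m. mat_power (cube n k) (cube_walk n k) m e (override_on e f S) > 0"
    if "finite S" "S \<subseteq> {1..n}" for S
    using that
  proof (induction S)
    case empty
    have "mat_power (cube n k) (cube_walk n k) 0 e e > 0" by (simp add: point_mass_def)
    then show ?case unfolding override_on_emptyset by blast
  next
    case (insert i S)
    then obtain m where m: "mat_power (cube n k) (cube_walk n k) m e (override_on e f S) > 0" by blast
    have step: "cube_walk n k (override_on e f S) (override_on e f (insert i S)) > 0"
    proof (cases "override_on e f S = override_on e f (insert i S)")
      case False
      then have "override_on e f S i \<noteq> override_on e f (insert i S) i"
        by (auto simp: override_on_def fun_eq_iff split: if_splits)
      moreover have "\<forall>j\<in>{1..n}-{i}. override_on e f S j = override_on e f (insert i S) j"
        by (simp add: override_on_def)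
      ultimately have "\<exists>l\<in>{1..n}. override_on e f S l \<noteq> override_on e f (insert i S) l \<and>
          (\<forall>j\<in>{1..n}-{l}. override_on e f S j = override_on e f (insert i S) j)"
        using insert.prems by (intro bexI[of _ i]) auto
      then show ?thesis using False assms by (simp add: cube_walk_def)
    qed (simp add: cube_walk_def)
    show ?case
      using insert.prems step
      by (intro exI[of _ "Suc m"] mat_power_Suc_pos[OF finite_cube cube_walk_nonneg _ m] mix) simp_all
  qed
  from this[of "{1..n}"]
  obtain m where "mat_power (cube n k) (cube_walk n k) m e (override_on e f {1..n}) > 0" by auto
  moreover have "override_on e f {1..n} = f"
    using ef by (intro cube_eqI[OF mix]) auto
  ultimately show "\<exists>m. mat_power (cube n k) (cube_walk n k) m e f > 0" by auto
qed

lemma cube_walk_aperiodic: "aperiodic_chain (cube n k) (cube_walk n k)"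
  unfolding aperiodic_chain_def
proof
  fix e assume "e \<in> cube n k"
  have "mat_power (cube n k) (cube_walk n k) (Suc 0) e e > 0"
    by (rule mat_power_Suc_pos[OF finite_cube cube_walk_nonneg \<open>e \<in> cube n k\<close>])
       (simp_all add: point_mass_def cube_walk_def)
  then have "Gcd {m. m > 0 \<and> mat_power (cube n k) (cube_walk n k) m e e > 0} dvd Suc 0"
    by (intro Gcd_dvd) simp
  then show "Gcd {m. m > 0 \<and> mat_power (cube n k) (cube_walk n k) m e e > 0} = 1"
    by simp
qed

lemma cube_walk_ergodic:
  assumes "n \<ge> 1" "k \<ge> 1"
  shows "ergodic_chain (cube n k) (point_mass (const_state n 0)) (cube_walk n k) (uniform (cube n k))"
  unfolding ergodic_chain_def
  using assms by (intro conjI finite_cube prob_vector_point_mass const_state_in_cube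
    cube_walk_stochastic cube_walk_irreducible cube_walk_aperiodic cube_walk_stationary) auto

section \<open>The dual walk\<close>

text \<open>
  The update \<open>r\<close> is coded as a state whose entries equal to \<open>k\<close> mark the coordinates to be raised. The
  map preserves the cube whatever \<open>r\<close> is, so a chain driven by it stays in the cube surely.
\<close>

definition raise_marked :: "nat \<Rightarrow> nat \<Rightarrow> (nat \<Rightarrow> nat) \<Rightarrow> (nat \<Rightarrow> nat) \<Rightarrow> (nat \<Rightarrow> nat)" where
  "raise_marked n k r e = (\<lambda>i\<in>{1..n}. if r i = k then k else e i)"

text \<open>
  The randomness of the dual: at a refresh the chosen coordinate is marked. For \<open>k \<ge> 1\<close> the
  state \<open>corner n k {}\<close> marks none.
\<close>

definition mark_pmf :: "nat \<Rightarrow> nat \<Rightarrow> (nat \<Rightarrow> nat) pmf" where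
  "mark_pmf n k = bind_pmf (bernoulli_pmf (refresh_prob k)) (\<lambda>b.
     if b then bind_pmf (pmf_of_set {1..n}) (\<lambda>i. return_pmf (corner n k {i}))
     else return_pmf (corner n k {}))"

definition dual_walk :: "nat \<Rightarrow> nat \<Rightarrow> (nat \<Rightarrow> nat) \<Rightarrow> (nat \<Rightarrow> nat) \<Rightarrow> real" where
  "dual_walk n k e = pmf (map_pmf (\<lambda>r. raise_marked n k r e) (mark_pmf n k))"

lemma raise_marked_in_cube: "e \<in> cube n k \<Longrightarrow> raise_marked n k r e \<in> cube n k"
  by (auto simp: cube_def raise_marked_def)

lemma raise_marked_corner_empty:
  assumes "e \<in> cube n k" "k \<ge> 1"
  shows "raise_marked n k (corner n k {}) e = e"
  using assms by (intro cube_eqI[OF raise_marked_in_cube]) (auto simp: raise_marked_def corner_def)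

lemma raise_marked_corner_singleton:
  assumes "e \<in> cube n k" "k \<ge> 1" "i \<in> {1..n}"
  shows "raise_marked n k (corner n k {i}) e = e(i := k)"
  using assms
  by (intro cube_eqI[OF raise_marked_in_cube fun_upd_cube]) (auto simp: raise_marked_def corner_def)

lemma refresh_prob_bounds: "k \<ge> 1 \<Longrightarrow> refresh_prob k \<in> {0..1}"
  by (simp add: refresh_prob_def field_simps)

lemma pmf_return_eq_point_mass: "pmf (return_pmf a) f = point_mass a f"
  by (simp add: point_mass_def)

lemma dual_walk_eq:
  assumes "n \<ge> 1" "k \<ge> 1" "e \<in> cube n k"
  shows "dual_walk n k e f = (1 - refresh_prob k) * point_mass e f
    + refresh_prob k / real n * (\<Sum>i=1..n. point_mass (e(i := k)) f)"
proof -
  have "dual_walk n k e f = refresh_prob k *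
      ((\<Sum>i=1..n. pmf (return_pmf (raise_marked n k (corner n k {i}) e)) f) / real n)
      + (1 - refresh_prob k) * pmf (return_pmf (raise_marked n k (corner n k {}) e)) f"
    using assms refresh_prob_bounds[of k]
    by (simp add: dual_walk_def mark_pmf_def map_bind_pmf pmf_bind integral_pmf_of_set if_distrib
      cong: if_cong)
  also have "\<dots> = refresh_prob k * ((\<Sum>i=1..n. point_mass (e(i := k)) f) / real n)
      + (1 - refresh_prob k) * point_mass e f"
    using raise_marked_corner_singleton[OF assms(3,2)] raise_marked_corner_empty[OF assms(3,2)]
    by (simp add: pmf_return_eq_point_mass del: pmf_return)
  finally show ?thesis by (simp add: add.commute)
qed

lemma dual_walk_action:
  assumes "n \<ge> 1" "k \<ge> 1" "e \<in> cube n k"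
  shows "(\<Sum>f\<in>cube n k. dual_walk n k e f * h f) = (1 - refresh_prob k) * h e
    + refresh_prob k / real n * (\<Sum>i=1..n. h (e(i := k)))"
proof -
  have "(\<Sum>f\<in>cube n k. dual_walk n k e f * h f)
      = (1 - refresh_prob k) * (\<Sum>f\<in>cube n k. point_mass e f * h f)
      + refresh_prob k / real n * (\<Sum>i=1..n. \<Sum>f\<in>cube n k. point_mass (e(i := k)) f * h f)"
    unfolding dual_walk_eq[OF assms] distrib_right sum.distrib
    by (simp add: sum_distrib_left sum_distrib_right mult.assoc sum.swap[of _ _ "cube n k"])
  then show ?thesis
    using assms by (simp add: sum_point_mass finite_cube fun_upd_cube)
qed

lemma dual_walk_corner:
  assumes "n \<ge> 1" "k \<ge> 1"
  shows "dual_walk n k (corner n k A) f = (1 - refresh_prob k) * point_mass (corner n k A) f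
    + refresh_prob k / real n * (\<Sum>i=1..n. point_mass (corner n k (A \<union> {i})) f)"
  using dual_walk_eq[OF assms corner_in_cube] corner_fun_upd by simp

lemma dual_walk_corner_step:
  assumes "n \<ge> 1" "k \<ge> 1" "A \<subseteq> {1..n}" "j \<in> {1..n} - A"
  shows "dual_walk n k (corner n k A) (corner n k (A \<union> {j})) = (real k + 1) / (2 * real n * real k)"
proof -
  have "point_mass (corner n k (A \<union> {i})) (corner n k (A \<union> {j})) = (if i = j then 1 else 0)"
    if "i \<in> {1..n}" for i
  proof -
    have "corner n k (A \<union> {j}) = corner n k (A \<union> {i}) \<longleftrightarrow> A \<union> {j} = A \<union> {i}"
      using assms that by (intro corner_eq_iff) auto
    then show ?thesis using assms(4) by (auto simp: point_mass_def)
  qed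
  then have "(\<Sum>i=1..n. point_mass (corner n k (A \<union> {i})) (corner n k (A \<union> {j}))) = 1"
    using assms(4) by simp
  moreover have "corner n k (A \<union> {j}) \<noteq> corner n k A"
    using assms by (subst corner_eq_iff) auto
  ultimately show ?thesis
    unfolding dual_walk_corner[OF assms(1,2)] by (simp add: point_mass_def refresh_prob_def)
qed

text \<open>
  Besides the steps without a refresh, the dual stays where it is when the refreshed coordinate has
  been raised already, that is, lies in \<open>A\<close>.
\<close>

lemma dual_walk_corner_stay:
  assumes "n \<ge> 1" "k \<ge> 1" "A \<subseteq> {1..n}"
  shows "dual_walk n k (corner n k A) (corner n k A)
    = (real n * (real k - 1) + real (card A) * (real k + 1)) / (2 * real n * real k)"
proof -
  have "point_mass (corner n k (A \<union> {i})) (corner n k A) = (if i \<in> A then 1 else 0)"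
    if "i \<in> {1..n}" for i
  proof -
    have "corner n k A = corner n k (A \<union> {i}) \<longleftrightarrow> A = A \<union> {i}"
      using assms that by (intro corner_eq_iff) auto
    then show ?thesis by (auto simp: point_mass_def)
  qed
  then have "(\<Sum>i=1..n. point_mass (corner n k (A \<union> {i})) (corner n k A))
      = (\<Sum>i=1..n. if i \<in> A then 1 else 0)"
    by (intro sum.cong) auto
  also have "\<dots> = real (card A)"
    using assms(3) by (simp add: sum.If_cases Int_absorb1)
  finally show ?thesis
    using assms(1,2) unfolding dual_walk_corner[OF assms(1,2)]
    by (simp add: point_mass_def refresh_prob_def field_simps)
qed

lemma dual_walk_corner_other:
  assumes "n \<ge> 1" "k \<ge> 1" "e \<noteq> corner n k A" "\<forall>j\<in>{1..n} - A. e \<noteq> corner n k (A \<union> {j})"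
  shows "dual_walk n k (corner n k A) e = 0"
proof -
  have "e \<noteq> corner n k (A \<union> {i})" if "i \<in> {1..n}" for i
    using assms(3,4) that by (cases "i \<in> A") (auto simp: insert_absorb)
  then show ?thesis
    unfolding dual_walk_corner[OF assms(1,2)] using assms(3) by (simp add: point_mass_def)
qed

section \<open>The link\<close>

text \<open>
  The product law in which the coordinates where \<open>d\<close> equals \<open>k\<close> are uniform on \<open>{0..k}\<close> and the other
  coordinates are still those of \<open>d\<close>. For a corner \<open>d\<close> with \<open>k \<ge> 1\<close> this is the conditional law of
  the walk from the origin, given that exactly the coordinates with \<open>d i = k\<close> have been refreshed.
\<close>

definition partial_uniform :: "nat \<Rightarrow> nat \<Rightarrow> (nat \<Rightarrow> nat) \<Rightarrow> (nat \<Rightarrow> nat) \<Rightarrow> real" where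
  "partial_uniform n k d e =
     (\<Prod>i\<in>{1..n}. if d i = k then 1 / (real k + 1) else point_mass (d i) (e i))"

lemma partial_uniform_factor_sum:
  assumes "a \<le> k"
  shows "(\<Sum>c=0..k. if a = k then 1 / (real k + 1) else point_mass a c) = 1"
  using assms by (cases "a = k") (simp_all add: point_mass_def)

text \<open>
  Replacing coordinate \<open>i\<close> by a uniform value turns its factor in the product law into the
  uniform one, whatever it was before; this is the effect of raising \<open>d i\<close> to \<open>k\<close>.
\<close>

lemma partial_uniform_average:
  assumes "d \<in> cube n k" "i \<in> {1..n}"
  shows "(\<Sum>c=0..k. partial_uniform n k d (f(i := c))) / (real k + 1)
    = partial_uniform n k (d(i := k)) f"
proof -
  let ?u = "\<lambda>j c. if d j = k then 1 / (real k + 1) else point_mass (d j) c"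
  have "(\<Sum>c=0..k. ?u i c) = 1"
    using assms by (intro partial_uniform_factor_sum) (auto simp: cube_def)
  moreover have "partial_uniform n k d (f(i := c)) = ?u i c * (\<Prod>j\<in>{1..n}-{i}. ?u j (f j))" for c
  proof -
    have "(\<Prod>j\<in>{1..n}-{i}. ?u j ((f(i := c)) j)) = (\<Prod>j\<in>{1..n}-{i}. ?u j (f j))"
      by (intro prod.cong) auto
    then show ?thesis
      unfolding partial_uniform_def using assms(2) by (subst prod.remove[of _ i]) simp_all
  qed
  ultimately have "(\<Sum>c=0..k. partial_uniform n k d (f(i := c))) = (\<Prod>j\<in>{1..n}-{i}. ?u j (f j))"
    by (simp add: sum_distrib_right[symmetric])
  moreover have "partial_uniform n k (d(i := k)) f
      = 1 / (real k + 1) * (\<Prod>j\<in>{1..n}-{i}. ?u j (f j))"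
  proof -
    have "(\<Prod>j\<in>{1..n}-{i}. if (d(i := k)) j = k then 1 / (real k + 1) else point_mass ((d(i := k)) j) (f j))
        = (\<Prod>j\<in>{1..n}-{i}. ?u j (f j))"
      by (intro prod.cong) auto
    then show ?thesis
      unfolding partial_uniform_def using assms(2) by (subst prod.remove[of _ i]) simp_all
  qed
  ultimately show ?thesis by simp
qed

lemma partial_uniform_intertwines:
  assumes "n \<ge> 1" "k \<ge> 1" "d \<in> cube n k" "f \<in> cube n k"
  shows "mat_mult (cube n k) (partial_uniform n k) (cube_walk n k) d f
    = mat_mult (cube n k) (dual_walk n k) (partial_uniform n k) d f"
proof -
  have "mat_mult (cube n k) (partial_uniform n k) (cube_walk n k) d f
      = (\<Sum>e\<in>cube n k. cube_walk n k f e * partial_uniform n k d e)"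
    unfolding mat_mult_def by (subst cube_walk_sym) (simp add: mult.commute)
  also have "\<dots> = (1 - refresh_prob k) * partial_uniform n k d f
      + refresh_prob k / real n * (\<Sum>i=1..n. partial_uniform n k (d(i := k)) f)"
    using assms by (simp add: cube_walk_action partial_uniform_average)
  finally show ?thesis
    unfolding mat_mult_def dual_walk_action[OF assms(1-3)] .
qed

lemma partial_uniform_stochastic: "stochastic_kernel (cube n k) (cube n k) (partial_uniform n k)"
  unfolding stochastic_kernel_def prob_vector_def
proof (intro ballI conjI)
  fix d assume d: "d \<in> cube n k"
  show "0 \<le> partial_uniform n k d e" for e
    unfolding partial_uniform_def by (intro prod_nonneg) (auto simp: point_mass_def)
  have one: "(\<Sum>c=0..k. if d i = k then 1 / (real k + 1) else point_mass (d i) c) = 1"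
    if "i \<in> {1..n}" for i
    using d that by (intro partial_uniform_factor_sum) (auto simp: cube_def)
  show "(\<Sum>e\<in>cube n k. partial_uniform n k d e) = 1"
    unfolding partial_uniform_def cube_def
    by (subst prod_sum_PiE[symmetric]) (use one in auto)
qed

lemma partial_uniform_const_top: "partial_uniform n k (const_state n k) e = uniform (cube n k) e"
  by (simp add: partial_uniform_def const_state_def uniform_def card_cube power_one_over field_simps)

lemma partial_uniform_const_0:
  assumes "k \<ge> 1" "e \<in> cube n k"
  shows "partial_uniform n k (const_state n 0) e = point_mass (const_state n 0) e"
proof (cases "e = const_state n 0")
  case True
  then show ?thesis using assms by (simp add: partial_uniform_def const_state_def point_mass_def)
next
  case False
  then obtain i where "i \<in> {1..n}" "e i \<noteq> const_state n 0 i"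
    using cube_eqI[OF assms(2) const_state_in_cube] by blast
  then show ?thesis using assms False
    unfolding partial_uniform_def by (auto simp: const_state_def point_mass_def)
qed

text \<open>
  An unraised coordinate is deterministic and different from \<open>k\<close>. This is what makes the dual sharp:
  the top corner is reachable by the link from the absorbing state only.
\<close>

lemma partial_uniform_at_top:
  assumes "d \<in> cube n k" "d \<noteq> const_state n k"
  shows "partial_uniform n k d (const_state n k) = 0"
proof -
  obtain i where "i \<in> {1..n}" "d i \<noteq> const_state n k i"
    using cube_eqI[OF assms(1) const_state_in_cube] assms(2) by blast
  then show ?thesis
    unfolding partial_uniform_def by (auto simp: const_state_def point_mass_def)
qed

section \<open>The sharp strong stationary dual\<close>

theorem theorem3p3:
  fixes n k :: nat
  assumes "n \<ge> 1" and "k \<ge> 1"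
  shows "\<exists>(M :: (nat \<Rightarrow> nat \<Rightarrow> nat) measure)
           (X' :: nat \<Rightarrow> (nat \<Rightarrow> nat \<Rightarrow> nat) \<Rightarrow> (nat \<Rightarrow> nat))
           (P' :: (nat \<Rightarrow> nat) \<Rightarrow> (nat \<Rightarrow> nat) \<Rightarrow> real).
     sharp_strong_stationary_dual
       (cube n k) (point_mass (const_state n 0)) (cube_walk n k) (uniform (cube n k))
       M X' (cube n k) (point_mass (const_state n 0)) P' (const_state n k) \<and>
     (\<forall>A\<subseteq>{1..n}. \<forall>j\<in>{1..n} - A.
        P' (corner n k A) (corner n k (A \<union> {j})) = (real k + 1) / (2 * real n * real k)) \<and>
     (\<forall>A\<subseteq>{1..n}.
        P' (corner n k A) (corner n k A) =
          (real n * (real k - 1) + real (card A) * (real k + 1)) / (2 * real n * real k)) \<and>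
     (\<forall>A\<subseteq>{1..n}. \<forall>e\<in>cube n k.
        e \<noteq> corner n k A \<longrightarrow> (\<forall>j\<in>{1..n} - A. e \<noteq> corner n k (A \<union> {j})) \<longrightarrow>
        P' (corner n k A) e = 0)"
proof -
  let ?E = "cube n k" and ?\<nu> = "point_mass (const_state n 0)" and ?a = "const_state n k"
  define M where "M = PiM UNIV (\<lambda>_::nat. measure_pmf (mark_pmf n k))"
  define X' where "X' = driven_chain (raise_marked n k) (const_state n 0)"
  have bottom: "const_state n 0 \<in> ?E" and top: "?a \<in> ?E"
    by (simp_all add: const_state_in_cube)
  have chain: "markov_chain M X' ?E ?\<nu> (dual_walk n k)"
    unfolding M_def X'_def dual_walk_def
    by (rule markov_chain_driven[OF finite_cube bottom raise_marked_in_cube])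
  have absorbing: "dual_walk n k ?a ?a = 1"
    unfolding const_state_top dual_walk_corner_stay[OF assms subset_refl]
    using assms by (simp add: field_simps)
  have link: "strong_stationary_link ?E ?\<nu> (cube_walk n k) (uniform ?E)
      ?E ?\<nu> (dual_walk n k) ?a (partial_uniform n k)"
    unfolding strong_stationary_link_def
  proof (intro conjI ballI)
    show "?\<nu> e = vec_mult ?E ?\<nu> (partial_uniform n k) e" if "e \<in> ?E" for e
      using that assms by (simp add: vec_mult_def sum_point_mass finite_cube bottom partial_uniform_const_0)
  qed (simp_all only: partial_uniform_stochastic partial_uniform_const_top
         partial_uniform_intertwines[OF assms])
  have "separation ?E (vec_mult ?E ?\<nu> (mat_power ?E (cube_walk n k) m)) (uniform ?E)
      = \<P>(\<omega> in M. enat m < absorption_time X' ?a \<omega>)" for m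
  proof -
    have "separation ?E (vec_mult ?E ?\<nu> (mat_power ?E (cube_walk n k) m)) (uniform ?E)
        = 1 - vec_mult ?E ?\<nu> (mat_power ?E (dual_walk n k) m) ?a"
    proof (rule separation_eq_unabsorbed_mass[OF link finite_cube finite_cube _ _ _ top top])
      show "prob_vector ?E ?\<nu>" "stochastic_kernel ?E ?E (dual_walk n k)"
        using chain by (simp_all add: markov_chain_def)
    qed (simp_all add: partial_uniform_at_top uniform_def card_cube)
    then show ?thesis
      using absorption_time_tail[OF chain, OF top absorbing] by simp
  qed
  then have sharp: "sharp_strong_stationary_dual ?E ?\<nu> (cube_walk n k) (uniform ?E)
      M X' ?E ?\<nu> (dual_walk n k) ?a"
    unfolding sharp_strong_stationary_dual_def strong_stationary_dual_def
    by (intro conjI allI exI[of _ "partial_uniform n k"] cube_walk_ergodic[OF assms] chain top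
      absorbing link)
  show ?thesis
  proof (rule exI[of _ M], rule exI[of _ X'], rule exI[of _ "dual_walk n k"], intro conjI allI impI ballI)
  qed (rule sharp dual_walk_corner_step[OF assms] dual_walk_corner_stay[OF assms]
         dual_walk_corner_other[OF assms]; assumption)+
qed

end
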